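(* Let $G=E_8$ be the simply connected compact Lie group of type $E_8$, let $m$ be a positive integer and $p$ a prime. Write $m=p^i m'$ with $p\nmid m'$. Then $N(E_8,m,p)$ is the number of tuples $(b_1,\dots,b_8)\in\mathbb{Z}^8\cup(\mathbb{Z}+\frac12)^8$ such that $$b_2>\dots>b_7>|b_8|,\quad b_1>b_2+\dots+b_7-b_8,\quad p^i>b_1+b_2,\quad 2\mid(b_1+\dots+b_8).$$
   Context: Let $G$ be a simply connected simple compact Lie group with maximal torus $T$ and weight lattice $\Pi^*=\mathrm{Hom}(T,S^1)$. $\langle\cdot,\cdot\rangle$ is the unique Weyl-invariant inner product on $\Pi^*$ (extended to $\Pi^*\otimes\mathbb{R}$) with $\langle u,u\rangle=2$ for all long roots $u$ (in the simply laced case all roots are long). The fundamental Weyl chamber $V\subset\Pi^*\otimes\mathbb{R}$ is the set of points having non-negative inner product with all positive roots; $\theta$ is the highest root. The level $m$ fundamental alcove is $A=\{x\in V:\langle\theta,x\rangle\le m\}$. A level $m$ regular weight is an element of $\Pi^*$ in the interior of $A$. $N(G,m,p)$ denotes the number of level $m$ regular weights $a$ such that for every weight $w\in\Pi^*$ the denominator (in lowest terms) of the rational number $\langle w,a\rangle/m$ is a power $p^k$, $k\ge0$, of $p$. *)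

theory Defs
  imports "HOL-Analysis.Analysis" "HOL-Computational_Algebra.Primes"
begin

text \<open>
  A simply connected simple compact Lie group \<open>G\<close> with maximal torus \<open>T\<close> is represented by its
  root system \<open>\<Phi>\<close> in \<open>'a = Hom(T,S^1) \<otimes> \<real>\<close>. The inner product of \<open>'a\<close> is automatically
  Weyl-invariant, because the reflections in \<open>root_system\<close> are orthogonal for it; predicate
  \<open>normalized\<close> fixes its scale.
\<close>

definition cartan_number :: "'a::euclidean_space \<Rightarrow> 'a \<Rightarrow> real" where
  "cartan_number x \<alpha> = 2 * (x \<bullet> \<alpha>) / (\<alpha> \<bullet> \<alpha>)"

definition root_system :: "'a::euclidean_space set \<Rightarrow> bool" where
  "root_system \<Phi> \<longleftrightarrow>
     finite \<Phi> \<and> 0 \<notin> \<Phi> \<and> span \<Phi> = UNIV \<and>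
     (\<forall>\<alpha>\<in>\<Phi>. \<forall>\<beta>\<in>\<Phi>. \<beta> - cartan_number \<beta> \<alpha> *\<^sub>R \<alpha> \<in> \<Phi>) \<and>
     (\<forall>\<alpha>\<in>\<Phi>. \<forall>\<beta>\<in>\<Phi>. cartan_number \<beta> \<alpha> \<in> \<int>) \<and>
     (\<forall>\<alpha>\<in>\<Phi>. \<forall>c. c *\<^sub>R \<alpha> \<in> \<Phi> \<longrightarrow> c = 1 \<or> c = -1)"

definition nonneg_combinations :: "'a::euclidean_space set \<Rightarrow> 'a set" where
  "nonneg_combinations \<Delta> = {\<Sum>\<delta>\<in>\<Delta>. real (c \<delta>) *\<^sub>R \<delta> | c :: 'a \<Rightarrow> nat. True}"

definition root_base :: "'a::euclidean_space set \<Rightarrow> 'a set \<Rightarrow> bool" where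
  "root_base \<Phi> \<Delta> \<longleftrightarrow>
     \<Delta> \<subseteq> \<Phi> \<and> independent \<Delta> \<and>
     (\<forall>\<beta>\<in>\<Phi>. \<beta> \<in> nonneg_combinations \<Delta> \<or> - \<beta> \<in> nonneg_combinations \<Delta>)"

definition positive_roots :: "'a::euclidean_space set \<Rightarrow> 'a set \<Rightarrow> 'a set" where
  "positive_roots \<Phi> \<Delta> = \<Phi> \<inter> nonneg_combinations \<Delta>"

definition highest_root :: "'a::euclidean_space set \<Rightarrow> 'a set \<Rightarrow> 'a" where
  "highest_root \<Phi> \<Delta> = (THE \<theta>. \<theta> \<in> \<Phi> \<and> (\<forall>\<beta>\<in>\<Phi>. \<theta> - \<beta> \<in> nonneg_combinations \<Delta>))"

definition long_root :: "'a::euclidean_space set \<Rightarrow> 'a \<Rightarrow> bool" where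
  "long_root \<Phi> u \<longleftrightarrow> u \<in> \<Phi> \<and> (\<forall>\<beta>\<in>\<Phi>. \<beta> \<bullet> \<beta> \<le> u \<bullet> u)"

definition normalized :: "'a::euclidean_space set \<Rightarrow> bool" where
  "normalized \<Phi> \<longleftrightarrow> (\<forall>u. long_root \<Phi> u \<longrightarrow> u \<bullet> u = 2)"

text \<open>
  The vertices are numbered \<open>1,\<dots>,8\<close> as in Bourbaki: the chain \<open>1 - 3 - 4 - 5 - 6 - 7 - 8\<close>
  with \<open>2\<close> attached to \<open>4\<close>.
\<close>

definition E8_cartan_matrix :: "nat \<Rightarrow> nat \<Rightarrow> real" where
  "E8_cartan_matrix i j =
     (if i = j then 2
      else if {i, j} \<in> {{1, 3}, {3, 4}, {2, 4}, {4, 5}, {5, 6}, {6, 7}, {7, 8}} then -1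
      else 0)"

definition type_E8 :: "'a::euclidean_space set \<Rightarrow> bool" where
  "type_E8 \<Delta> \<longleftrightarrow>
     (\<exists>\<alpha> :: nat \<Rightarrow> 'a. bij_betw \<alpha> {1..8} \<Delta> \<and>
        (\<forall>i\<in>{1..8}. \<forall>j\<in>{1..8}. cartan_number (\<alpha> i) (\<alpha> j) = E8_cartan_matrix i j))"

text \<open>
  For simply connected \<open>G\<close> the lattice \<open>Hom(T,S^1)\<close> consists of all points that pair
  integrally with every coroot \<open>2\<alpha>/(\<alpha> \<bullet> \<alpha>)\<close>.
\<close>

definition weight_lattice :: "'a::euclidean_space set \<Rightarrow> 'a set" where
  "weight_lattice \<Phi> = {x. \<forall>\<alpha>\<in>\<Phi>. cartan_number x \<alpha> \<in> \<int>}"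

definition weyl_chamber :: "'a::euclidean_space set \<Rightarrow> 'a set \<Rightarrow> 'a set" where
  "weyl_chamber \<Phi> \<Delta> = {x. \<forall>\<alpha>\<in>positive_roots \<Phi> \<Delta>. 0 \<le> \<alpha> \<bullet> x}"

definition alcove :: "'a::euclidean_space set \<Rightarrow> 'a set \<Rightarrow> nat \<Rightarrow> 'a set" where
  "alcove \<Phi> \<Delta> m = {x \<in> weyl_chamber \<Phi> \<Delta>. highest_root \<Phi> \<Delta> \<bullet> x \<le> real m}"

definition regular_weights :: "'a::euclidean_space set \<Rightarrow> 'a set \<Rightarrow> nat \<Rightarrow> 'a set" where
  "regular_weights \<Phi> \<Delta> m = weight_lattice \<Phi> \<inter> interior (alcove \<Phi> \<Delta> m)"

text \<open>The second component of \<^const>\<open>quotient_of\<close> is the positive denominator in lowest terms.\<close>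

definition regular_weight_count :: "'a::euclidean_space set \<Rightarrow> 'a set \<Rightarrow> nat \<Rightarrow> nat \<Rightarrow> nat" where
  "regular_weight_count \<Phi> \<Delta> m p =
     card {a \<in> regular_weights \<Phi> \<Delta> m.
             \<forall>w\<in>weight_lattice \<Phi>. \<exists>q k. (w \<bullet> a) / real m = of_rat q \<and>
                snd (quotient_of q) = int p ^ k}"

end

theory Submission
  imports Defs
begin

text \<open>
  The \<open>E\<^sub>8\<close> root lattice is even and unimodular, so it coincides with the weight lattice. Hence
  \<open>\<langle>w,a\<rangle>/m\<close> has a power of \<open>p\<close> as its denominator for every weight \<open>w\<close> precisely when
  \<open>m'\<close> divides \<open>\<langle>w,a\<rangle>\<close> for every \<open>w\<close>, that is, when \<open>b = a/m'\<close> is again a weight. The alcove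
  inequalities for \<open>a\<close> at level \<open>m\<close> become those for \<open>b\<close> at level \<open>p^i\<close>, and the
  stated conditions are the result of writing \<open>b\<close> in the standard coordinates of \<open>E\<^sub>8\<close>.
\<close>

section \<open>Index sets with eight elements\<close>

lemma atLeastAtMost_1_8: "{1..8::nat} = {1, 2, 3, 4, 5, 6, 7, 8}"
  by auto

lemma sum_1_8:
  fixes f :: "nat \<Rightarrow> 'b::comm_monoid_add"
  shows "(\<Sum>i=1..8. f i) = f 1 + f 2 + f 3 + f 4 + f 5 + f 6 + f 7 + f 8"
  unfolding atLeastAtMost_1_8 by (simp add: add.assoc)

lemma UNIV_8: "(UNIV :: 8 set) = {1, 2, 3, 4, 5, 6, 7, 8}"
proof -
  have "x \<in> {1, 2, 3, 4, 5, 6, 7, 8}" for x :: 8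
  proof (induct x)
    case (of_int z)
    then have "z \<in> {0..<8}" by simp
    then have "z = 0 \<or> z = 1 \<or> z = 2 \<or> z = 3 \<or> z = 4 \<or> z = 5 \<or> z = 6 \<or> z = 7" by auto
    \<comment> \<open>Numerals of type \<open>8\<close> count modulo 8, so the case
      \<open>z = 0\<close> is the element \<open>8\<close>.\<close>
    then show ?case by auto
  qed
  then show ?thesis by blast
qed

lemma sum_8: "sum f (UNIV :: 8 set) = f 1 + f 2 + f 3 + f 4 + f 5 + f 6 + f 7 + f 8"
  unfolding UNIV_8 by (simp add: add.assoc)

lemma forall_8: "(\<forall>i::8. P i) \<longleftrightarrow> P 1 \<and> P 2 \<and> P 3 \<and> P 4 \<and> P 5 \<and> P 6 \<and> P 7 \<and> P 8"
  by (metis UNIV_8 UNIV_I insertE empty_iff)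

section \<open>The Cartan matrix of \<open>E8\<close> and its inverse\<close>

text \<open>The Cartan matrix has determinant 1, so its inverse has integer entries; unimodularity
  enters through this. Lists count from 0, whence the shifts by 1.\<close>

definition E8_inverse_cartan :: "nat \<Rightarrow> nat \<Rightarrow> int" where
  "E8_inverse_cartan i j =
     [[ 4,  5,  7, 10,  8,  6,  4, 2],
      [ 5,  8, 10, 15, 12,  9,  6, 3],
      [ 7, 10, 14, 20, 16, 12,  8, 4],
      [10, 15, 20, 30, 24, 18, 12, 6],
      [ 8, 12, 16, 24, 20, 15, 10, 5],
      [ 6,  9, 12, 18, 15, 12,  8, 4],
      [ 4,  6,  8, 12, 10,  8,  6, 3],
      [ 2,  3,  4,  6,  5,  4,  3, 2]] ! (i - 1) ! (j - 1)"

lemma E8_inverse_cartan_mult: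
  assumes "i \<in> {1..8}" "k \<in> {1..8}"
  shows "(\<Sum>j=1..8. of_int (E8_inverse_cartan i j) * E8_cartan_matrix j k) = (if i = k then 1 else 0)"
  using assms unfolding sum_1_8 unfolding atLeastAtMost_1_8
  by (elim insertE emptyE; hypsubst; simp add: E8_cartan_matrix_def E8_inverse_cartan_def doubleton_eq_iff)

lemma sum_E8_cartan_matrix:
  "(\<Sum>j=1..8. f j * E8_cartan_matrix j 1) = 2 * f 1 - f 3"
  "(\<Sum>j=1..8. f j * E8_cartan_matrix j 2) = 2 * f 2 - f 4"
  "(\<Sum>j=1..8. f j * E8_cartan_matrix j 3) = 2 * f 3 - f 1 - f 4"
  "(\<Sum>j=1..8. f j * E8_cartan_matrix j 4) = 2 * f 4 - f 2 - f 3 - f 5"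
  "(\<Sum>j=1..8. f j * E8_cartan_matrix j 5) = 2 * f 5 - f 4 - f 6"
  "(\<Sum>j=1..8. f j * E8_cartan_matrix j 6) = 2 * f 6 - f 5 - f 7"
  "(\<Sum>j=1..8. f j * E8_cartan_matrix j 7) = 2 * f 7 - f 6 - f 8"
  "(\<Sum>j=1..8. f j * E8_cartan_matrix j 8) = 2 * f 8 - f 7"
  unfolding sum_1_8 by (simp_all add: E8_cartan_matrix_def doubleton_eq_iff)

text \<open>Each diagonal entry is 2 and each edge of the diagram contributes two entries -1, so the
  form is twice the squares minus the products over the seven edges.\<close>

lemma E8_form_even:
  "(\<Sum>i=1..8. of_int (n i) * (\<Sum>j=1..8. of_int (n j) * E8_cartan_matrix j i)) =
   2 * of_int (n 1 * n 1 + n 2 * n 2 + n 3 * n 3 + n 4 * n 4 + n 5 * n 5 + n 6 * n 6 + n 7 * n 7 + n 8 * n 8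
      - (n 1 * n 3 + n 3 * n 4 + n 2 * n 4 + n 4 * n 5 + n 5 * n 6 + n 6 * n 7 + n 7 * n 8))"
  unfolding sum_1_8[where f = "\<lambda>i. of_int (n i) * (\<Sum>j=1..8. of_int (n j) * E8_cartan_matrix j i)"]
    sum_E8_cartan_matrix
  by (simp add: algebra_simps)

section \<open>Vectors whose Gram matrix is proportional to the Cartan matrix\<close>

text \<open>The parameter \<open>c\<close> is half the common squared length of the vectors \<open>\<alpha> i\<close>.\<close>

locale E8_gram =
  fixes \<alpha> :: "nat \<Rightarrow> 'a::euclidean_space" and c :: real
  assumes c_pos: "c > 0"
    and gram: "\<And>i j. i \<in> {1..8} \<Longrightarrow> j \<in> {1..8} \<Longrightarrow> \<alpha> i \<bullet> \<alpha> j = c * E8_cartan_matrix i j"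
    and spanning: "span (\<alpha> ` {1..8}) = UNIV"
begin

text \<open>The fundamental weights. Written through the inverse matrix, they are visibly integer
  combinations of the \<open>\<alpha> i\<close>.\<close>

definition \<omega> :: "nat \<Rightarrow> 'a" where
  "\<omega> i = (\<Sum>j=1..8. of_int (E8_inverse_cartan i j) *\<^sub>R \<alpha> j)"

definition lattice :: "'a set" where
  "lattice = {\<Sum>i=1..8. of_int (n i) *\<^sub>R \<alpha> i | n. True}"

text \<open>Such an \<open>x\<close> is orthogonal to the whole space, in particular to itself.
  Vector identities are reduced to inner products with the \<open>\<alpha> i\<close> in this
  way.\<close>

lemma eq_zeroI:
  assumes "\<And>i. i \<in> {1..8} \<Longrightarrow> x \<bullet> \<alpha> i = 0"
  shows "x = 0"
proof -
  have "orthogonal x y" if "y \<in> span (\<alpha> ` {1..8})" for y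
    by (rule orthogonal_to_span[OF that]) (use assms in \<open>auto simp: orthogonal_def\<close>)
  then have "orthogonal x x" using spanning by simp
  then show ?thesis by (simp add: orthogonal_def)
qed

lemma inner_\<omega>:
  assumes "i \<in> {1..8}" "k \<in> {1..8}"
  shows "\<omega> i \<bullet> \<alpha> k = (if i = k then c else 0)"
proof -
  have "\<omega> i \<bullet> \<alpha> k = (\<Sum>j=1..8. of_int (E8_inverse_cartan i j) * (c * E8_cartan_matrix j k))"
    unfolding \<omega>_def inner_sum_left using gram assms by (intro sum.cong) auto
  also have "\<dots> = c * (\<Sum>j=1..8. of_int (E8_inverse_cartan i j) * E8_cartan_matrix j k)"
    by (simp add: sum_distrib_left mult_ac)
  finally show ?thesis using E8_inverse_cartan_mult[OF assms] by simp
qed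

lemma inner_sum_\<omega>:
  assumes "k \<in> {1..8}"
  shows "(\<Sum>i=1..8. f i *\<^sub>R \<omega> i) \<bullet> \<alpha> k = c * f k"
proof -
  have "(\<Sum>i=1..8. f i *\<^sub>R \<omega> i) \<bullet> \<alpha> k = (\<Sum>i=1..8. if i = k then c * f k else 0)"
    unfolding inner_sum_left using inner_\<omega> assms by (intro sum.cong) auto
  then show ?thesis using assms by simp
qed

text \<open>Both sides have the same inner product with every \<open>\<alpha> k\<close>; the factor
  \<open>c\<close> balances the one in \<open>inner_\<omega>\<close>.\<close>

lemma expand_\<omega>: "c *\<^sub>R x = (\<Sum>i=1..8. (x \<bullet> \<alpha> i) *\<^sub>R \<omega> i)"
proof -
  have "c *\<^sub>R x - (\<Sum>i=1..8. (x \<bullet> \<alpha> i) *\<^sub>R \<omega> i) = 0"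
    by (rule eq_zeroI) (simp add: inner_diff_left inner_sum_\<omega> del: One_nat_def)
  then show ?thesis by simp
qed

lemma sum_\<alpha>_in_lattice: "(\<Sum>i=1..8. of_int (n i) *\<^sub>R \<alpha> i) \<in> lattice"
  unfolding lattice_def by blast

lemma \<omega>_in_lattice: "\<omega> i \<in> lattice"
  unfolding \<omega>_def by (rule sum_\<alpha>_in_lattice)

lemma sum_in_lattice:
  assumes "\<And>i::nat. i \<in> {1..8} \<Longrightarrow> f i \<in> lattice"
  shows "(\<Sum>i=1..8. of_int (h i) *\<^sub>R f i) \<in> lattice"
proof -
  have "\<forall>i\<in>{1..8}. \<exists>n. f i = (\<Sum>j=1..8. of_int (n j) *\<^sub>R \<alpha> j)"
    using assms unfolding lattice_def by blast
  then obtain n where n: "\<And>i. i \<in> {1..8} \<Longrightarrow> f i = (\<Sum>j=1..8. of_int (n i j) *\<^sub>R \<alpha> j)"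
    by metis
  have "(\<Sum>i=1..8. of_int (h i) *\<^sub>R f i)
      = (\<Sum>i=1..8. \<Sum>j=1..8. of_int (h i * n i j) *\<^sub>R \<alpha> j)"
    using n by (intro sum.cong) (auto simp: scaleR_sum_right)
  also have "\<dots> = (\<Sum>j=1..8. of_int (\<Sum>i=1..8. h i * n i j) *\<^sub>R \<alpha> j)"
    unfolding of_int_sum scaleR_sum_left by (rule sum.swap)
  finally show ?thesis by (simp only: sum_\<alpha>_in_lattice)
qed

lemma inner_lattice_Ints:
  assumes "x \<in> lattice" "\<And>i. i \<in> {1..8} \<Longrightarrow> y \<bullet> \<alpha> i \<in> \<int>"
  shows "y \<bullet> x \<in> \<int>"
proof -
  obtain n where n: "x = (\<Sum>i=1..8. of_int (n i) *\<^sub>R \<alpha> i)"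
    using assms(1) unfolding lattice_def by blast
  show ?thesis
    unfolding n inner_sum_right inner_scaleR_right by (intro Ints_sum Ints_mult Ints_of_int assms(2))
qed

text \<open>Expanding the square in the coefficients of \<open>x\<close> gives \<open>c\<close>
  times the form of \<open>E8_form_even\<close>.\<close>

lemma lattice_even:
  assumes "x \<in> lattice"
  obtains q :: int where "x \<bullet> x = 2 * c * of_int q"
proof -
  obtain n where n: "x = (\<Sum>i=1..8. of_int (n i) *\<^sub>R \<alpha> i)"
    using assms unfolding lattice_def by blast
  have "x \<bullet> x = (\<Sum>i=1..8. \<Sum>j=1..8. of_int (n i) * (of_int (n j) * (\<alpha> j \<bullet> \<alpha> i)))"
    unfolding n inner_sum_left inner_sum_right
    by (simp only: inner_scaleR_left inner_scaleR_right)
  also have "\<dots> = (\<Sum>i=1..8. \<Sum>j=1..8. c * (of_int (n i) * (of_int (n j) * E8_cartan_matrix j i)))"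
    by (intro sum.cong refl) (simp only: gram mult_ac)
  also have "\<dots> = c * (\<Sum>i=1..8. of_int (n i) * (\<Sum>j=1..8. of_int (n j) * E8_cartan_matrix j i))"
    by (simp only: sum_distrib_left)
  finally have x: "x \<bullet> x = c * (\<Sum>i=1..8. of_int (n i) * (\<Sum>j=1..8. of_int (n j) * E8_cartan_matrix j i))" .
  obtain Q where Q: "(\<Sum>i=1..8. of_int (n i) * (\<Sum>j=1..8. of_int (n j) * E8_cartan_matrix j i)) = 2 * of_int Q"
    using E8_form_even by blast
  have "x \<bullet> x = 2 * c * of_int Q" unfolding x Q by simp
  then show thesis by (rule that)
qed

end

section \<open>Simple roots and root lengths\<close>

text \<open>The numbering hidden in the existential of \<open>type_E8\<close> becomes a
  parameter.\<close>

locale E8_roots =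
  fixes \<Phi> \<Delta> :: "'a::euclidean_space set" and \<alpha> :: "nat \<Rightarrow> 'a"
  assumes root_system: "root_system \<Phi>"
    and root_base: "root_base \<Phi> \<Delta>"
    and normalized: "normalized \<Phi>"
    and bij_\<alpha>: "bij_betw \<alpha> {1..8} \<Delta>"
    and cartan_\<alpha>: "\<And>i j. i \<in> {1..8} \<Longrightarrow> j \<in> {1..8} \<Longrightarrow> cartan_number (\<alpha> i) (\<alpha> j) = E8_cartan_matrix i j"
begin

lemma \<alpha>_root: "i \<in> {1..8} \<Longrightarrow> \<alpha> i \<in> \<Phi>"
  using bij_\<alpha> root_base unfolding root_base_def bij_betw_def by blast

lemma root_nonzero: "\<beta> \<in> \<Phi> \<Longrightarrow> \<beta> \<noteq> 0"
  using root_system unfolding root_system_def by blast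

text \<open>Coefficients are carried along the numbering, so that later sums run over
  \<open>{1..8}\<close> instead of \<open>\<Delta>\<close>.\<close>

lemma nonneg_combinations_iff:
  "x \<in> nonneg_combinations \<Delta> \<longleftrightarrow> (\<exists>n::nat \<Rightarrow> nat. x = (\<Sum>i=1..8. real (n i) *\<^sub>R \<alpha> i))"
proof
  assume "x \<in> nonneg_combinations \<Delta>"
  then obtain c :: "'a \<Rightarrow> nat" where c: "x = (\<Sum>\<delta>\<in>\<Delta>. real (c \<delta>) *\<^sub>R \<delta>)"
    unfolding nonneg_combinations_def by blast
  have "x = (\<Sum>i=1..8. real (c (\<alpha> i)) *\<^sub>R \<alpha> i)"
    unfolding c by (rule sum.reindex_bij_betw[OF bij_\<alpha>, symmetric])
  then show "\<exists>n::nat \<Rightarrow> nat. x = (\<Sum>i=1..8. real (n i) *\<^sub>R \<alpha> i)" by (rule exI[of _ "\<lambda>i. c (\<alpha> i)"])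
next
  assume "\<exists>n::nat \<Rightarrow> nat. x = (\<Sum>i=1..8. real (n i) *\<^sub>R \<alpha> i)"
  then obtain n :: "nat \<Rightarrow> nat" where n: "x = (\<Sum>i=1..8. real (n i) *\<^sub>R \<alpha> i)" by blast
  define c where "c \<delta> = n (inv_into {1..8} \<alpha> \<delta>)" for \<delta>
  have "c (\<alpha> i) = n i" if "i \<in> {1..8}" for i
    using that bij_\<alpha> unfolding c_def bij_betw_def by simp
  then have "x = (\<Sum>i=1..8. real (c (\<alpha> i)) *\<^sub>R \<alpha> i)"
    unfolding n by (intro sum.cong) auto
  also have "\<dots> = (\<Sum>\<delta>\<in>\<Delta>. real (c \<delta>) *\<^sub>R \<delta>)"
    by (rule sum.reindex_bij_betw[OF bij_\<alpha>])
  finally show "x \<in> nonneg_combinations \<Delta>" unfolding nonneg_combinations_def by blast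
qed

text \<open>Stated for any \<open>c\<close>, since the scale of the simple roots is not yet
  determined at its first use.\<close>

lemma root_in_lattice:
  assumes "\<beta> \<in> \<Phi>" and "E8_gram \<alpha> c"
  shows "\<beta> \<in> E8_gram.lattice \<alpha>"
proof -
  interpret E8_gram \<alpha> c by fact
  consider "\<beta> \<in> nonneg_combinations \<Delta>" | "- \<beta> \<in> nonneg_combinations \<Delta>"
    using root_base assms unfolding root_base_def by blast
  then have "\<exists>n. \<beta> = (\<Sum>i=1..8. of_int (n i) *\<^sub>R \<alpha> i)"
  proof cases
    case 1
    then obtain n :: "nat \<Rightarrow> nat" where "\<beta> = (\<Sum>i=1..8. of_int (int (n i)) *\<^sub>R \<alpha> i)"
      unfolding nonneg_combinations_iff by auto
    then show ?thesis by (intro exI)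
  next
    case 2
    then obtain n :: "nat \<Rightarrow> nat" where "- \<beta> = (\<Sum>i=1..8. real (n i) *\<^sub>R \<alpha> i)"
      unfolding nonneg_combinations_iff by auto
    then have "\<beta> = (\<Sum>i=1..8. of_int (- int (n i)) *\<^sub>R \<alpha> i)"
      by (simp add: sum_negf minus_equation_iff[of \<beta>])
    then show ?thesis by (intro exI)
  qed
  then show ?thesis unfolding lattice_def by blast
qed

lemma span_\<alpha>: "span (\<alpha> ` {1..8}) = UNIV"
proof -
  have sum: "(\<Sum>i=1..8. real (n i) *\<^sub>R \<alpha> i) \<in> span (\<alpha> ` {1..8})" for n :: "nat \<Rightarrow> nat"
    by (intro span_sum span_scale span_base) auto
  have "\<Phi> \<subseteq> span (\<alpha> ` {1..8})"
  proof
    fix \<beta> assume "\<beta> \<in> \<Phi>"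
    then have "\<beta> \<in> nonneg_combinations \<Delta> \<or> - \<beta> \<in> nonneg_combinations \<Delta>"
      using root_base unfolding root_base_def by blast
    then show "\<beta> \<in> span (\<alpha> ` {1..8})"
      unfolding nonneg_combinations_iff using sum by (metis span_neg minus_minus)
  qed
  then have "span \<Phi> \<subseteq> span (\<alpha> ` {1..8})" by (simp add: span_minimal)
  then show ?thesis using root_system unfolding root_system_def by auto
qed

text \<open>Both Cartan numbers of an edge are -1, which forces equal lengths at its ends, and the
  diagram is connected.\<close>

lemma \<alpha>_same_length:
  assumes "i \<in> {1..8}"
  shows "\<alpha> i \<bullet> \<alpha> i = \<alpha> 1 \<bullet> \<alpha> 1"
proof -
  have adjacent: "\<alpha> i \<bullet> \<alpha> i = \<alpha> j \<bullet> \<alpha> j"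
    if "i \<in> {1..8}" "j \<in> {1..8}" "E8_cartan_matrix i j = -1" "E8_cartan_matrix j i = -1" for i j
  proof -
    have "\<alpha> i \<noteq> 0" "\<alpha> j \<noteq> 0" using that \<alpha>_root root_nonzero by blast+
    moreover have "2 * (\<alpha> i \<bullet> \<alpha> j) / (\<alpha> j \<bullet> \<alpha> j) = -1" "2 * (\<alpha> j \<bullet> \<alpha> i) / (\<alpha> i \<bullet> \<alpha> i) = -1"
      using that cartan_\<alpha> unfolding cartan_number_def by metis+
    ultimately show ?thesis by (simp add: field_simps inner_commute)
  qed
  have "\<alpha> 1 \<bullet> \<alpha> 1 = \<alpha> 3 \<bullet> \<alpha> 3" "\<alpha> 3 \<bullet> \<alpha> 3 = \<alpha> 4 \<bullet> \<alpha> 4" "\<alpha> 2 \<bullet> \<alpha> 2 = \<alpha> 4 \<bullet> \<alpha> 4"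
    "\<alpha> 4 \<bullet> \<alpha> 4 = \<alpha> 5 \<bullet> \<alpha> 5" "\<alpha> 5 \<bullet> \<alpha> 5 = \<alpha> 6 \<bullet> \<alpha> 6" "\<alpha> 6 \<bullet> \<alpha> 6 = \<alpha> 7 \<bullet> \<alpha> 7" "\<alpha> 7 \<bullet> \<alpha> 7 = \<alpha> 8 \<bullet> \<alpha> 8"
    by (rule adjacent; simp add: E8_cartan_matrix_def doubleton_eq_iff)+
  then show ?thesis using assms unfolding atLeastAtMost_1_8 by auto
qed

text \<open>The scale stays a parameter here: \<open>normalized\<close> speaks of long roots only,
  and the simple roots are not yet known to be long.\<close>

lemma E8_gram_\<alpha>: "E8_gram \<alpha> ((\<alpha> 1 \<bullet> \<alpha> 1) / 2)"
proof
  show "(\<alpha> 1 \<bullet> \<alpha> 1) / 2 > 0" using \<alpha>_root[of 1] root_nonzero by simp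
  show "span (\<alpha> ` {1..8}) = UNIV" by (rule span_\<alpha>)
  fix i j :: nat assume ij: "i \<in> {1..8}" "j \<in> {1..8}"
  then have "\<alpha> j \<noteq> 0" using \<alpha>_root root_nonzero by blast
  moreover have "2 * (\<alpha> i \<bullet> \<alpha> j) / (\<alpha> j \<bullet> \<alpha> j) = E8_cartan_matrix i j"
    using cartan_\<alpha>[OF ij] unfolding cartan_number_def .
  ultimately have "2 * (\<alpha> i \<bullet> \<alpha> j) = E8_cartan_matrix i j * (\<alpha> j \<bullet> \<alpha> j)"
    by (simp add: field_simps)
  then show "\<alpha> i \<bullet> \<alpha> j = (\<alpha> 1 \<bullet> \<alpha> 1) / 2 * E8_cartan_matrix i j"
    using \<alpha>_same_length[OF ij(2)] by (simp add: mult.commute)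
qed

text \<open>
  If \<open>\<beta>\<close> has squared length \<open>k\<close> times that of the simple roots, then integrality of
  \<open>2(\<alpha> i \<bullet> \<beta>)/(\<beta> \<bullet> \<beta>)\<close> and unimodularity of the lattice make \<open>\<beta>\<close> divisible by \<open>k\<close> in it,
  which is impossible for \<open>k > 1\<close> because the lattice is even.
\<close>

lemma root_same_length:
  assumes "\<beta> \<in> \<Phi>"
  shows "\<beta> \<bullet> \<beta> = \<alpha> 1 \<bullet> \<alpha> 1"
proof -
  define c where "c = (\<alpha> 1 \<bullet> \<alpha> 1) / 2"
  interpret E8_gram \<alpha> c unfolding c_def by (rule E8_gram_\<alpha>)
  obtain k where k: "\<beta> \<bullet> \<beta> = 2 * c * of_int k"
    using lattice_even root_in_lattice[OF assms E8_gram_axioms] .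
  have "\<beta> \<bullet> \<beta> > 0" using root_nonzero[OF assms] by simp
  then have k_pos: "k > 0" unfolding k using c_pos by (simp add: zero_less_mult_iff)
  have "\<forall>i\<in>{1..8}. \<exists>y. cartan_number (\<alpha> i) \<beta> = of_int y"
    using root_system \<alpha>_root assms unfolding root_system_def by (metis Ints_cases)
  then obtain y where y: "\<And>i. i \<in> {1..8} \<Longrightarrow> cartan_number (\<alpha> i) \<beta> = of_int (y i)"
    by metis
  have inner: "\<beta> \<bullet> \<alpha> i = c * k * y i" if "i \<in> {1..8}" for i
    using y[OF that] c_pos k_pos unfolding cartan_number_def k
    by (simp add: field_simps inner_commute)
  \<comment> \<open>The inner products of \<open>\<beta>\<close> with the \<open>\<alpha> i\<close>
    are \<open>k\<close> times those of this lattice vector.\<close>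
  define \<gamma> where "\<gamma> = (\<Sum>i=1..8. of_int (y i) *\<^sub>R \<omega> i)"
  have "c *\<^sub>R \<beta> = c *\<^sub>R (of_int k *\<^sub>R \<gamma>)"
    unfolding expand_\<omega>[of \<beta>] \<gamma>_def by (simp add: scaleR_sum_right inner mult.assoc del: One_nat_def)
  then have \<beta>: "\<beta> = of_int k *\<^sub>R \<gamma>" using c_pos by (simp del: scaleR_scaleR)
  have "\<gamma> \<in> lattice" unfolding \<gamma>_def by (rule sum_in_lattice[OF \<omega>_in_lattice])
  then obtain q where q: "\<gamma> \<bullet> \<gamma> = 2 * c * of_int q" using lattice_even by blast
  \<comment> \<open>Computing the squared length of \<open>\<beta> = k \<gamma>\<close> in two ways
    gives \<open>2 c k = k^2 (2 c q)\<close>, so the integers satisfy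
    \<open>k q = 1\<close>.\<close>
  have "(2 * c * of_int k) * of_int (k * q) = (2 * c * of_int k) * 1"
    using k unfolding \<beta> by (auto simp: q)
  then have "real_of_int (k * q) = 1"
    unfolding mult_cancel_left using c_pos k_pos by auto
  then have "k * q = 1" by linarith
  then have "k = 1" using k_pos by (simp add: pos_zmult_eq_1_iff)
  then have "\<beta> \<bullet> \<beta> = 2 * c" using k by simp
  also have "\<dots> = \<alpha> 1 \<bullet> \<alpha> 1" unfolding c_def by simp
  finally show ?thesis .
qed

text \<open>As all roots have the same length, \<open>\<alpha> 1\<close> is long and the
  normalization applies to it.\<close>

lemma \<alpha>_norm: "\<alpha> 1 \<bullet> \<alpha> 1 = 2"
proof -
  have "long_root \<Phi> (\<alpha> 1)"
    unfolding long_root_def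
  proof (intro conjI ballI)
    show "\<alpha> 1 \<in> \<Phi>" by (rule \<alpha>_root) simp
    show "\<beta> \<bullet> \<beta> \<le> \<alpha> 1 \<bullet> \<alpha> 1" if "\<beta> \<in> \<Phi>" for \<beta>
      by (rule eq_refl[OF root_same_length[OF that]])
  qed
  then show ?thesis by (rule normalized[unfolded normalized_def, rule_format])
qed

text \<open>From here on \<open>c\<close> is 1, and \<open>\<omega>\<close> is the exact dual basis
  of the simple roots.\<close>

sublocale E8_gram \<alpha> 1
  using E8_gram_\<alpha> \<alpha>_norm by simp

lemma root_norm: "\<beta> \<in> \<Phi> \<Longrightarrow> \<beta> \<bullet> \<beta> = 2"
  using root_same_length[of \<beta>] \<alpha>_norm by (rule trans)

lemma cartan_number_root: "\<beta> \<in> \<Phi> \<Longrightarrow> cartan_number x \<beta> = x \<bullet> \<beta>"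
  by (simp add: cartan_number_def root_norm)

section \<open>The highest root\<close>

text \<open>Vertex 8 is singled out because \<open>\<omega> 8\<close> will be the highest root; row
  8 of the inverse matrix lists its coefficients.\<close>

lemma inner_\<omega>_8: "x \<bullet> \<omega> 8 = (\<Sum>j=1..8. of_int (E8_inverse_cartan 8 j) * (x \<bullet> \<alpha> j))"
  unfolding \<omega>_def inner_sum_right by simp

lemma \<omega>_8_norm: "\<omega> 8 \<bullet> \<omega> 8 = 2"
  unfolding inner_\<omega>_8 sum_1_8 by (simp add: inner_\<omega> E8_inverse_cartan_def)

text \<open>
  The last row of the inverse Cartan matrix has entries at least \<open>2\<close>, so a nonzero dominant \<open>\<gamma>\<close>
  has \<open>\<gamma> \<bullet> \<omega> 8 \<ge> 2\<close>; as both vectors have squared length \<open>2\<close>, they are equal.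
\<close>

lemma dominant_root_eq:
  assumes "\<gamma> \<in> \<Phi>" and dominant: "\<And>i. i \<in> {1..8} \<Longrightarrow> \<gamma> \<bullet> \<alpha> i \<ge> 0"
  shows "\<gamma> = \<omega> 8"
proof -
  have Ints: "\<gamma> \<bullet> \<alpha> i \<in> \<int>" if "i \<in> {1..8}" for i
    using root_system \<alpha>_root[OF that] assms(1) cartan_number_root unfolding root_system_def by metis
  obtain k where k: "k \<in> {1..8}" "\<gamma> \<bullet> \<alpha> k \<noteq> 0"
    using eq_zeroI root_nonzero[OF assms(1)] by blast
  then have "\<gamma> \<bullet> \<alpha> k \<ge> 1"
    using Ints[OF k(1)] dominant[OF k(1)] by (auto elim!: Ints_cases)
  moreover have inv: "E8_inverse_cartan 8 j \<ge> 2" if "j \<in> {1..8}" for j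
    using that unfolding atLeastAtMost_1_8 by (auto simp: E8_inverse_cartan_def)
  moreover have "\<gamma> \<bullet> \<omega> 8 \<ge> of_int (E8_inverse_cartan 8 k) * (\<gamma> \<bullet> \<alpha> k)"
    unfolding inner_\<omega>_8
  proof (rule member_le_sum[OF k(1)])
    show "0 \<le> of_int (E8_inverse_cartan 8 j) * (\<gamma> \<bullet> \<alpha> j)" if "j \<in> {1..8} - {k}" for j
      using inv[of j] dominant[of j] that by simp
  qed simp
  moreover have "of_int (E8_inverse_cartan 8 k) * (\<gamma> \<bullet> \<alpha> k) \<ge> 2 * 1"
    using inv[OF k(1)] \<open>\<gamma> \<bullet> \<alpha> k \<ge> 1\<close> by (intro mult_mono) auto
  ultimately have "\<gamma> \<bullet> \<omega> 8 \<ge> 2" by linarith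
  moreover have "\<gamma> \<bullet> \<gamma> = 2" by (rule root_norm[OF assms(1)])
  ultimately have "(\<gamma> - \<omega> 8) \<bullet> (\<gamma> - \<omega> 8) \<le> 0"
    using \<omega>_8_norm by (simp add: inner_diff inner_commute)
  then show ?thesis by (metis inner_gt_zero_iff not_le right_minus_eq)
qed

lemma add_\<alpha>_nonneg_combinations:
  assumes "x \<in> nonneg_combinations \<Delta>" "i \<in> {1..8}"
  shows "x + real k *\<^sub>R \<alpha> i \<in> nonneg_combinations \<Delta>"
proof -
  obtain n :: "nat \<Rightarrow> nat" where n: "x = (\<Sum>j=1..8. real (n j) *\<^sub>R \<alpha> j)"
    using assms(1) unfolding nonneg_combinations_iff by blast
  have "real k *\<^sub>R \<alpha> i = (\<Sum>j=1..8. if j = i then real k *\<^sub>R \<alpha> j else 0)"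
    using assms(2) by simp
  then have "x + real k *\<^sub>R \<alpha> i = (\<Sum>j=1..8. real (if j = i then n j + k else n j) *\<^sub>R \<alpha> j)"
    unfolding n by (simp only: sum.distrib[symmetric]) (intro sum.cong, auto simp: algebra_simps)
  then show ?thesis
    unfolding nonneg_combinations_iff by (rule exI[of _ "\<lambda>j. if j = i then n j + k else n j"])
qed

text \<open>
  A root \<open>\<gamma> \<ge> \<beta>\<close> of maximal height is dominant: otherwise reflecting it in a simple root
  would increase its height.
\<close>

lemma \<omega>_8_highest:
  assumes "\<beta> \<in> \<Phi>"
  shows "\<omega> 8 \<in> \<Phi>" and "\<omega> 8 - \<beta> \<in> nonneg_combinations \<Delta>"
proof -
  \<comment> \<open>The Weyl vector: the inner product with it is the height. The factor 1 makes
    \<open>inner_sum_\<omega>\<close> applicable.\<close>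
  define \<rho> where "\<rho> = (\<Sum>i=1..8. 1 *\<^sub>R \<omega> i)"
  have \<rho>: "\<rho> \<bullet> \<alpha> i = 1" if "i \<in> {1..8}" for i
    unfolding \<rho>_def inner_sum_\<omega>[OF that] by simp
  define S where "S = {\<gamma> \<in> \<Phi>. \<gamma> - \<beta> \<in> nonneg_combinations \<Delta>}"
  have "finite S" using root_system unfolding S_def root_system_def by simp
  have "0 \<in> nonneg_combinations \<Delta>"
    unfolding nonneg_combinations_iff by (rule exI[of _ "\<lambda>_. 0"]) simp
  then have "\<beta> \<in> S" using assms unfolding S_def by simp
  then obtain \<gamma> where \<gamma>: "\<gamma> \<in> S" "\<And>\<gamma>'. \<gamma>' \<in> S \<Longrightarrow> \<rho> \<bullet> \<gamma>' \<le> \<rho> \<bullet> \<gamma>"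
    using obtains_MAX[OF \<open>finite S\<close>, of "\<lambda>\<gamma>. \<rho> \<bullet> \<gamma>"] \<open>finite S\<close>
    by (metis Max_ge empty_iff finite_imageI image_eqI)
  then have \<gamma>_root: "\<gamma> \<in> \<Phi>" unfolding S_def by simp
  have "\<gamma> \<bullet> \<alpha> i \<ge> 0" if i: "i \<in> {1..8}" for i
  proof (rule ccontr)
    assume neg: "\<not> \<gamma> \<bullet> \<alpha> i \<ge> 0"
    have "cartan_number \<gamma> (\<alpha> i) \<in> \<int>" "\<gamma> - cartan_number \<gamma> (\<alpha> i) *\<^sub>R \<alpha> i \<in> \<Phi>"
      using root_system \<alpha>_root[OF i] \<gamma>_root unfolding root_system_def by blast+
    then obtain z where z: "\<gamma> \<bullet> \<alpha> i = of_int z" and refl: "\<gamma> - of_int z *\<^sub>R \<alpha> i \<in> \<Phi>"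
      unfolding cartan_number_root[OF \<alpha>_root[OF i]] by (metis Ints_cases)
    define k where "k = nat (- z)"
    have k: "of_int z = - real k" "real k > 0" using neg z unfolding k_def by auto
    have "(\<gamma> - \<beta>) + real k *\<^sub>R \<alpha> i \<in> nonneg_combinations \<Delta>"
      using \<gamma>(1) i unfolding S_def by (intro add_\<alpha>_nonneg_combinations) auto
    then have "\<gamma> + real k *\<^sub>R \<alpha> i \<in> S"
      using refl unfolding S_def k(1) by (simp add: algebra_simps)
    from \<gamma>(2)[OF this] show False
      using k(2) \<rho>[OF i] by (simp add: inner_add_right)
  qed
  then have "\<gamma> = \<omega> 8" using dominant_root_eq[OF \<gamma>_root] by blast
  then show "\<omega> 8 \<in> \<Phi>" "\<omega> 8 - \<beta> \<in> nonneg_combinations \<Delta>"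
    using \<gamma>(1) unfolding S_def by auto
qed

text \<open>The inner product with \<open>\<omega> i\<close> reads off the coefficient at
  \<open>\<alpha> i\<close>, which is non-negative for \<open>x\<close> and for \<open>- x\<close>.
  This yields uniqueness of the highest root.\<close>

lemma nonneg_combinations_antisym:
  assumes "x \<in> nonneg_combinations \<Delta>" "- x \<in> nonneg_combinations \<Delta>"
  shows "x = 0"
proof -
  have nonneg: "\<omega> i \<bullet> y \<ge> 0" if "y \<in> nonneg_combinations \<Delta>" "i \<in> {1..8}" for i y
    using that unfolding nonneg_combinations_iff
    by (auto simp: inner_sum_right inner_\<omega> intro!: sum_nonneg simp del: One_nat_def)
  have "\<omega> i \<bullet> x = 0" if "i \<in> {1..8}" for i
    using nonneg[OF assms(1) that] nonneg[OF assms(2) that] by simp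
  moreover have "x \<bullet> x = (\<Sum>i=1..8. (x \<bullet> \<alpha> i) * (\<omega> i \<bullet> x))"
    using arg_cong[OF expand_\<omega>[of x], of "\<lambda>y. y \<bullet> x"] by (simp add: inner_sum_left)
  ultimately have "x \<bullet> x = 0" by (simp del: One_nat_def)
  then show ?thesis by simp
qed

lemma highest_root_eq: "highest_root \<Phi> \<Delta> = \<omega> 8"
  unfolding highest_root_def
proof (rule the_equality)
  \<comment> \<open>\<open>\<omega>_8_highest\<close> starts from a given root, so one has to be
    exhibited.\<close>
  have "\<alpha> 1 \<in> \<Phi>" by (rule \<alpha>_root) simp
  then show *: "\<omega> 8 \<in> \<Phi> \<and> (\<forall>\<beta>\<in>\<Phi>. \<omega> 8 - \<beta> \<in> nonneg_combinations \<Delta>)"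
    using \<omega>_8_highest by blast
  fix \<theta> assume "\<theta> \<in> \<Phi> \<and> (\<forall>\<beta>\<in>\<Phi>. \<theta> - \<beta> \<in> nonneg_combinations \<Delta>)"
  then have "\<theta> - \<omega> 8 = 0" using * by (intro nonneg_combinations_antisym) auto
  then show "\<theta> = \<omega> 8" by simp
qed

section \<open>Weyl chamber and alcove\<close>

text \<open>Simple roots are positive, and positive roots are non-negative combinations of
  them.\<close>

lemma weyl_chamber_eq: "weyl_chamber \<Phi> \<Delta> = {x. \<forall>i\<in>{1..8}. 0 \<le> \<alpha> i \<bullet> x}"
proof (intro equalityI subsetI)
  fix x assume x: "x \<in> weyl_chamber \<Phi> \<Delta>"
  have "\<alpha> i \<in> positive_roots \<Phi> \<Delta>" if "i \<in> {1..8}" for i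
  proof -
    have "0 \<in> nonneg_combinations \<Delta>"
      unfolding nonneg_combinations_iff by (rule exI[of _ "\<lambda>_. 0"]) simp
    then show ?thesis
      using add_\<alpha>_nonneg_combinations[OF _ that, of 0 1] \<alpha>_root[OF that] unfolding positive_roots_def by simp
  qed
  then show "x \<in> {x. \<forall>i\<in>{1..8}. 0 \<le> \<alpha> i \<bullet> x}" using x unfolding weyl_chamber_def by blast
next
  fix x assume x: "x \<in> {x. \<forall>i\<in>{1..8}. 0 \<le> \<alpha> i \<bullet> x}"
  show "x \<in> weyl_chamber \<Phi> \<Delta>"
    unfolding weyl_chamber_def
  proof (intro CollectI ballI)
    fix \<beta> assume "\<beta> \<in> positive_roots \<Phi> \<Delta>"
    then have "\<beta> \<in> nonneg_combinations \<Delta>" unfolding positive_roots_def by blast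
    then obtain n :: "nat \<Rightarrow> nat" where n: "\<beta> = (\<Sum>i=1..8. real (n i) *\<^sub>R \<alpha> i)"
      unfolding nonneg_combinations_iff by blast
    show "0 \<le> \<beta> \<bullet> x"
      unfolding n inner_sum_left using x by (auto intro!: sum_nonneg)
  qed
qed

text \<open>The alcove lies in closed half-spaces with nonzero normals, whose interiors are the open
  ones; conversely the strict inequalities define an open subset.\<close>

lemma interior_alcove:
  "interior (alcove \<Phi> \<Delta> m) = {x. (\<forall>i\<in>{1..8}. 0 < \<alpha> i \<bullet> x) \<and> \<omega> 8 \<bullet> x < m}"
proof (intro equalityI subsetI)
  fix x assume x: "x \<in> interior (alcove \<Phi> \<Delta> m)"
  have "0 < \<alpha> i \<bullet> x" if "i \<in> {1..8}" for i
  proof -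
    have "alcove \<Phi> \<Delta> m \<subseteq> {x. 0 \<le> \<alpha> i \<bullet> x}"
      using that unfolding alcove_def weyl_chamber_eq by blast
    from interior_mono[OF this] show ?thesis
      using x root_nonzero[OF \<alpha>_root[OF that]] by (auto simp: interior_halfspace_ge)
  qed
  moreover have "\<omega> 8 \<bullet> x < m"
  proof -
    have "\<omega> 8 \<noteq> 0" using \<omega>_8_norm by auto
    moreover have "alcove \<Phi> \<Delta> m \<subseteq> {x. \<omega> 8 \<bullet> x \<le> m}"
      unfolding alcove_def highest_root_eq by blast
    from interior_mono[OF this] have "x \<in> interior {x. \<omega> 8 \<bullet> x \<le> m}" using x by blast
    ultimately show ?thesis by (simp add: interior_halfspace_le)
  qed
  ultimately show "x \<in> {x. (\<forall>i\<in>{1..8}. 0 < \<alpha> i \<bullet> x) \<and> \<omega> 8 \<bullet> x < m}" by blast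
next
  fix x assume x: "x \<in> {x. (\<forall>i\<in>{1..8}. 0 < \<alpha> i \<bullet> x) \<and> \<omega> 8 \<bullet> x < m}"
  have "{x. (\<forall>i\<in>{1..8}. 0 < \<alpha> i \<bullet> x) \<and> \<omega> 8 \<bullet> x < m}
      = (\<Inter>i\<in>{1..8}. {x. 0 < \<alpha> i \<bullet> x}) \<inter> {x. \<omega> 8 \<bullet> x < m}" by blast
  also have "open \<dots>"
    by (intro open_Int open_INT ballI open_Collect_less continuous_intros) auto
  finally have "open {x. (\<forall>i\<in>{1..8}. 0 < \<alpha> i \<bullet> x) \<and> \<omega> 8 \<bullet> x < m}" .
  moreover have "{x. (\<forall>i\<in>{1..8}. 0 < \<alpha> i \<bullet> x) \<and> \<omega> 8 \<bullet> x < m} \<subseteq> alcove \<Phi> \<Delta> m"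
    unfolding alcove_def weyl_chamber_eq highest_root_eq by (auto intro: less_imp_le)
  ultimately show "x \<in> interior (alcove \<Phi> \<Delta> m)"
    using x interior_maximal by blast
qed

section \<open>The weight lattice\<close>

text \<open>Cartan numbers against roots are now inner products, and every root is an integer
  combination of simple roots.\<close>

lemma weight_lattice_iff: "x \<in> weight_lattice \<Phi> \<longleftrightarrow> (\<forall>i\<in>{1..8}. x \<bullet> \<alpha> i \<in> \<int>)"
proof
  assume "x \<in> weight_lattice \<Phi>"
  then show "\<forall>i\<in>{1..8}. x \<bullet> \<alpha> i \<in> \<int>"
    unfolding weight_lattice_def using \<alpha>_root cartan_number_root by fastforce
next
  assume "\<forall>i\<in>{1..8}. x \<bullet> \<alpha> i \<in> \<int>"
  then show "x \<in> weight_lattice \<Phi>"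
    unfolding weight_lattice_def
    using inner_lattice_Ints[OF root_in_lattice[OF _ E8_gram_axioms]] cartan_number_root by auto
qed

lemma \<alpha>_weight: "i \<in> {1..8} \<Longrightarrow> \<alpha> i \<in> weight_lattice \<Phi>"
  using root_system \<alpha>_root unfolding weight_lattice_def root_system_def by blast

text \<open>A weight is an integer combination of the \<open>\<omega> i\<close>, which lie in the
  root lattice by unimodularity.\<close>

lemma weight_in_lattice:
  assumes "x \<in> weight_lattice \<Phi>"
  shows "x \<in> lattice"
proof -
  have "\<forall>i\<in>{1..8}. \<exists>n. x \<bullet> \<alpha> i = of_int n"
    using assms unfolding weight_lattice_iff by (metis Ints_cases)
  then obtain n where "\<And>i. i \<in> {1..8} \<Longrightarrow> x \<bullet> \<alpha> i = of_int (n i)" by metis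
  then have "x = (\<Sum>i=1..8. of_int (n i) *\<^sub>R \<omega> i)"
    using expand_\<omega>[of x] by (simp del: One_nat_def)
  then show ?thesis using sum_in_lattice[OF \<omega>_in_lattice, of n] by simp
qed

lemma inner_weights_Ints:
  assumes "x \<in> weight_lattice \<Phi>" "y \<in> weight_lattice \<Phi>"
  shows "x \<bullet> y \<in> \<int>"
  using inner_lattice_Ints[OF weight_in_lattice[OF assms(2)]] assms(1) weight_lattice_iff by blast

end

section \<open>Denominators that are powers of a prime\<close>

text \<open>If the denominator is \<open>p ^ k\<close>, then \<open>m'\<close> divides
  \<open>n * p ^ k\<close> and is coprime to \<open>p ^ k\<close>. Conversely \<open>m'\<close>
  cancels, and what remains has a denominator dividing \<open>p ^ i\<close>.\<close>

lemma prime_power_denominator_iff: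
  fixes m' p i :: nat and n :: int
  assumes "prime p" "m' > 0" "\<not> p dvd m'"
  shows "(\<exists>q k. real_of_int n / real (p ^ i * m') = of_rat q \<and> snd (quotient_of q) = int p ^ k)
    \<longleftrightarrow> int m' dvd n"
proof
  have p: "p > 0" using assms(1) prime_gt_0_nat by blast
  assume "\<exists>q k. real_of_int n / real (p ^ i * m') = of_rat q \<and> snd (quotient_of q) = int p ^ k"
  then obtain q k where q: "real_of_int n / real (p ^ i * m') = of_rat q" "snd (quotient_of q) = int p ^ k"
    by blast
  obtain r where r: "quotient_of q = (r, int p ^ k)" using q(2) by (cases "quotient_of q") auto
  have "real_of_rat q = real_of_int r / real p ^ k"
    unfolding quotient_of_div[OF r] by (simp add: of_rat_divide of_rat_power)
  then have "real_of_int n * real p ^ k = real_of_int r * (real p ^ i * real m')"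
    using q(1) p assms(2) by (simp add: field_simps)
  then have "real_of_int (n * int p ^ k) = real_of_int (r * (int p ^ i * int m'))" by simp
  then have "n * int p ^ k = r * (int p ^ i * int m')" by (simp only: of_int_eq_iff)
  then have "int m' dvd n * int p ^ k" by (metis dvd_triv_right mult.assoc)
  moreover have "coprime (int m') (int p ^ k)"
    using prime_imp_coprime[OF assms(1,3)] by (simp add: coprime_commute)
  ultimately show "int m' dvd n" by (simp add: coprime_dvd_mult_left_iff)
next
  have p: "p > 0" using assms(1) prime_gt_0_nat by blast
  assume "int m' dvd n"
  then obtain t where t: "n = int m' * t" by blast
  define q where "q = rat_of_int t / of_nat (p ^ i)"
  obtain a b where ab: "quotient_of q = (a, b)" by fastforce
  have b: "b > 0" "coprime a b" using quotient_of_denom_pos[OF ab] quotient_of_coprime[OF ab] by auto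
  have "rat_of_int a / of_int b = rat_of_int t / of_nat (p ^ i)"
    using quotient_of_div[OF ab] unfolding q_def by simp
  then have "rat_of_int (a * int p ^ i) = rat_of_int (t * b)"
    using p b(1) by (simp add: field_simps)
  then have "a * int p ^ i = t * b" by (simp only: of_int_eq_iff)
  then have "b dvd a * int p ^ i" by simp
  then have "b dvd int p ^ i" using b(2) by (simp add: coprime_commute coprime_dvd_mult_right_iff)
  moreover have "prime (int p)" using assms(1) by simp
  ultimately obtain k where "normalize b = int p ^ k" using divides_primepow by blast
  then have "snd (quotient_of q) = int p ^ k" using ab b(1) by simp
  moreover have "real_of_int n / real (p ^ i * m') = of_rat q"
    using assms(2) p unfolding t q_def by (simp add: of_rat_divide of_rat_power)
  ultimately show "\<exists>q k. real_of_int n / real (p ^ i * m') = of_rat q \<and> snd (quotient_of q) = int p ^ k"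
    by blast
qed

section \<open>Standard coordinates of \<open>E8\<close>\<close>

text \<open>
  The inner products of \<open>b\<close> with the simple roots of \<open>E\<^sub>8\<close> in Bourbaki's coordinates
  \<open>(b\<^sub>8, b\<^sub>7, \<dots>, b\<^sub>1)\<close>.
\<close>

definition simple_root_pairing :: "real ^ 8 \<Rightarrow> nat \<Rightarrow> real" where
  "simple_root_pairing b i =
     [(b $ 1 - b $ 2 - b $ 3 - b $ 4 - b $ 5 - b $ 6 - b $ 7 + b $ 8) / 2,
      b $ 7 + b $ 8, b $ 7 - b $ 8, b $ 6 - b $ 7, b $ 5 - b $ 6, b $ 4 - b $ 5, b $ 3 - b $ 4,
      b $ 2 - b $ 3] ! (i - 1)"

lemma simple_root_pairing_simps:
  "simple_root_pairing b 1 = (b $ 1 - b $ 2 - b $ 3 - b $ 4 - b $ 5 - b $ 6 - b $ 7 + b $ 8) / 2"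
  "simple_root_pairing b 2 = b $ 7 + b $ 8"
  "simple_root_pairing b 3 = b $ 7 - b $ 8"
  "simple_root_pairing b 4 = b $ 6 - b $ 7"
  "simple_root_pairing b 5 = b $ 5 - b $ 6"
  "simple_root_pairing b 6 = b $ 4 - b $ 5"
  "simple_root_pairing b 7 = b $ 3 - b $ 4"
  "simple_root_pairing b 8 = b $ 2 - b $ 3"
  by (simp_all add: simple_root_pairing_def)

lemma ball_1_8:
  "(\<forall>i\<in>{1..8::nat}. P i) \<longleftrightarrow> P 1 \<and> P 2 \<and> P 3 \<and> P 4 \<and> P 5 \<and> P 6 \<and> P 7 \<and> P 8"
  unfolding atLeastAtMost_1_8 by simp

lemma simple_root_pairing_inject:
  assumes "\<forall>i\<in>{1..8}. simple_root_pairing b i = simple_root_pairing b' i"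
  shows "b = b'"
proof -
  note eqs = assms[unfolded ball_1_8 simple_root_pairing_simps]
  have "b $ 7 = b' $ 7" "b $ 8 = b' $ 8" using eqs by simp_all
  with eqs have "b $ 1 = b' $ 1" "b $ 2 = b' $ 2" "b $ 3 = b' $ 3" "b $ 4 = b' $ 4" "b $ 5 = b' $ 5" "b $ 6 = b' $ 6"
    by simp_all
  with \<open>b $ 7 = b' $ 7\<close> \<open>b $ 8 = b' $ 8\<close> show ?thesis unfolding vec_eq_iff forall_8 by simp
qed

lemma simple_root_pairing_surj:
  obtains b where "\<forall>i\<in>{1..8}. simple_root_pairing b i = c i"
proof -
  \<comment> \<open>The system is triangular: \<open>s\<close> is \<open>b $ 7\<close>, each of
    \<open>b $ 6\<close> to \<open>b $ 2\<close> adds one difference, and \<open>b $ 1\<close> is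
    then solved from pairing 1.\<close>
  define s where "s = (c 2 + c 3) / 2"
  define b :: "real ^ 8" where "b = (\<chi> j.
    if j = 8 then (c 2 - c 3) / 2 else if j = 7 then s else if j = 6 then s + c 4
    else if j = 5 then s + c 4 + c 5 else if j = 4 then s + c 4 + c 5 + c 6
    else if j = 3 then s + c 4 + c 5 + c 6 + c 7 else if j = 2 then s + c 4 + c 5 + c 6 + c 7 + c 8
    else 2 * c 1 + 6 * s + 5 * c 4 + 4 * c 5 + 3 * c 6 + 2 * c 7 + c 8 - (c 2 - c 3) / 2)"
  have "b $ 8 = (c 2 - c 3) / 2" "b $ 7 = s" "b $ 6 = s + c 4" "b $ 5 = s + c 4 + c 5"
    "b $ 4 = s + c 4 + c 5 + c 6" "b $ 3 = s + c 4 + c 5 + c 6 + c 7"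
    "b $ 2 = s + c 4 + c 5 + c 6 + c 7 + c 8"
    "b $ 1 = 2 * c 1 + 6 * s + 5 * c 4 + 4 * c 5 + 3 * c 6 + 2 * c 7 + c 8 - (c 2 - c 3) / 2"
    unfolding b_def by simp_all
  then have "\<forall>i\<in>{1..8}. simple_root_pairing b i = c i"
    unfolding ball_1_8 simple_root_pairing_simps s_def by (simp add: field_simps)
  then show thesis by (rule that)
qed

text \<open>Integral differences put the coordinates \<open>b $ 2\<close> to \<open>b $ 8\<close> in
  one class modulo 1, and pairings 2 and 3 add up to \<open>2 * b $ 7\<close>, so this class is 0 or
  1/2.\<close>

lemma simple_root_pairing_Ints_imp:
  assumes "\<forall>i\<in>{1..8}. simple_root_pairing b i \<in> \<int>"
  shows "(\<forall>j. b $ j \<in> \<int>) \<or> (\<forall>j. b $ j - 1 / 2 \<in> \<int>)"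
    and "\<exists>k::int. (\<Sum>j\<in>UNIV. b $ j) = 2 * of_int k"
proof -
  have "\<forall>i\<in>{1..8}. \<exists>n. simple_root_pairing b i = of_int n"
    using assms by (metis Ints_cases)
  then obtain n where "\<forall>i\<in>{1..8}. simple_root_pairing b i = of_int (n i)" by metis
  note n = this[unfolded ball_1_8 simple_root_pairing_simps]
  show "\<exists>k::int. (\<Sum>j\<in>UNIV. b $ j) = 2 * of_int k"
    \<comment> \<open>By pairing 1 half the coordinate sum is
      \<open>n 1 + b $ 2 + ... + b $ 7\<close>; the terms in \<open>n 2\<close> and
      \<open>n 3\<close> come from \<open>6 * b $ 7\<close>.\<close>
    by (rule exI[of _ "n 1 + 3 * n 2 + 3 * n 3 + 5 * n 4 + 4 * n 5 + 3 * n 6 + 2 * n 7 + n 8"])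
      (use n in \<open>simp add: sum_8\<close>)
  obtain t where t: "n 2 + n 3 = 2 * t \<or> n 2 + n 3 = 2 * t + 1"
    by (metis evenE oddE)
  \<comment> \<open>The common fractional part of all coordinates.\<close>
  define s :: real where "s = b $ 7 - of_int t"
  have s: "s = 0 \<or> s = 1 / 2"
  proof -
    have "2 * b $ 7 = of_int (n 2 + n 3)" using n by simp
    then show ?thesis using t unfolding s_def by auto
  qed
  \<comment> \<open>Solving for \<open>b $ 1\<close> produces \<open>5 * b $ 7\<close>; four of
    these five make the integer \<open>2 * (n 2 + n 3)\<close>, so a single \<open>s\<close> is
    left.\<close>
  have "b $ 7 - s = of_int t" "b $ 8 - s = of_int (t - n 3)"
    "b $ 6 - s = of_int (t + n 4)" "b $ 5 - s = of_int (t + n 4 + n 5)"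
    "b $ 4 - s = of_int (t + n 4 + n 5 + n 6)" "b $ 3 - s = of_int (t + n 4 + n 5 + n 6 + n 7)"
    "b $ 2 - s = of_int (t + n 4 + n 5 + n 6 + n 7 + n 8)"
    "b $ 1 - s = of_int (2 * n 1 + 2 * n 2 + 3 * n 3 + 5 * n 4 + 4 * n 5 + 3 * n 6 + 2 * n 7 + n 8 + t)"
    using n s unfolding s_def by auto
  then have Ints: "\<forall>j. b $ j - s \<in> \<int>"
    unfolding forall_8 by (metis Ints_of_int)
  from s show "(\<forall>j. b $ j \<in> \<int>) \<or> (\<forall>j. b $ j - 1 / 2 \<in> \<int>)"
  proof
    assume "s = 0"
    then show ?thesis using Ints by simp
  next
    assume "s = 1 / 2"
    then show ?thesis using Ints by blast
  qed
qed

lemma simple_root_pairing_Ints_if: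
  assumes "(\<forall>j. b $ j \<in> \<int>) \<or> (\<forall>j. b $ j - 1 / 2 \<in> \<int>)"
    and "\<exists>k::int. (\<Sum>j\<in>UNIV. b $ j) = 2 * of_int k"
  shows "\<forall>i\<in>{1..8}. simple_root_pairing b i \<in> \<int>"
proof -
  \<comment> \<open>Taking \<open>e\<close> as 0 or 1 treats integral and half-integral coordinates
    together.\<close>
  obtain e :: int where "\<forall>j. b $ j - of_int e / 2 \<in> \<int>"
  proof (rule disjE[OF assms(1)])
    assume "\<forall>j. b $ j \<in> \<int>"
    then show thesis using that[of 0] by simp
  next
    assume "\<forall>j. b $ j - 1 / 2 \<in> \<int>"
    then show thesis using that[of 1] by simp
  qed
  then have "\<forall>j. \<exists>z. b $ j - of_int e / 2 = of_int z" by (metis Ints_cases)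
  then obtain z where z: "\<And>j. b $ j = of_int (z j) + of_int e / 2" by (metis diff_add_cancel)
  obtain k :: int where k: "(\<Sum>j\<in>UNIV. b $ j) = 2 * of_int k" using assms(2) by blast
  \<comment> \<open>Pairing 1 is half the coordinate sum minus \<open>b $ 2 + ... + b $ 7\<close>;
    here the parity condition is needed, and six halves of \<open>e\<close> give
    \<open>3 * e\<close>.\<close>
  have "simple_root_pairing b 1 = of_int (k - z 2 - z 3 - z 4 - z 5 - z 6 - z 7 - 3 * e)"
    using k unfolding simple_root_pairing_simps sum_8 z by simp
  moreover have "simple_root_pairing b 2 = of_int (z 7 + z 8 + e)"
    "simple_root_pairing b 3 = of_int (z 7 - z 8)" "simple_root_pairing b 4 = of_int (z 6 - z 7)"
    "simple_root_pairing b 5 = of_int (z 5 - z 6)" "simple_root_pairing b 6 = of_int (z 4 - z 5)"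
    "simple_root_pairing b 7 = of_int (z 3 - z 4)" "simple_root_pairing b 8 = of_int (z 2 - z 3)"
    unfolding simple_root_pairing_simps z by simp_all
  ultimately show ?thesis unfolding ball_1_8 by (metis Ints_of_int)
qed

section \<open>Counting regular weights in coordinates\<close>

context E8_roots
begin

text \<open>Each \<open>w \<bullet> a\<close> is an integer, so the condition says that it is
  divisible by \<open>m'\<close>. Simple roots are weights, so testing all \<open>w\<close> is
  enough to make \<open>a / m'\<close> a weight.\<close>

lemma prime_power_denominators_iff:
  fixes m' p i :: nat
  assumes "prime p" "m' > 0" "\<not> p dvd m'" and a: "a \<in> weight_lattice \<Phi>"
  shows "(\<forall>w\<in>weight_lattice \<Phi>. \<exists>q k. (w \<bullet> a) / real (p ^ i * m') = of_rat q \<and> snd (quotient_of q) = int p ^ k)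
    \<longleftrightarrow> (1 / real m') *\<^sub>R a \<in> weight_lattice \<Phi>"
proof -
  have iff: "(\<exists>q k. (w \<bullet> a) / real (p ^ i * m') = of_rat q \<and> snd (quotient_of q) = int p ^ k)
      \<longleftrightarrow> w \<bullet> ((1 / real m') *\<^sub>R a) \<in> \<int>" if w: "w \<in> weight_lattice \<Phi>" for w
  proof -
    obtain n where n: "w \<bullet> a = of_int n" using inner_weights_Ints[OF w a] by (elim Ints_cases)
    have "int m' dvd n \<longleftrightarrow> real_of_int n / real m' \<in> \<int>"
    proof
      assume "int m' dvd n"
      then show "real_of_int n / real m' \<in> \<int>" using assms(2) by auto
    next
      assume "real_of_int n / real m' \<in> \<int>"
      then obtain t where "real_of_int n / real m' = of_int t" by (elim Ints_cases)
      then have "real_of_int n = real_of_int (int m' * t)" using assms(2) by (simp add: field_simps)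
      then have "n = int m' * t" by (simp only: of_int_eq_iff)
      then show "int m' dvd n" by simp
    qed
    then show ?thesis unfolding n prime_power_denominator_iff[OF assms(1-3)] by (simp add: n)
  qed
  have "(\<forall>w\<in>weight_lattice \<Phi>. w \<bullet> ((1 / real m') *\<^sub>R a) \<in> \<int>) \<longleftrightarrow> (1 / real m') *\<^sub>R a \<in> weight_lattice \<Phi>"
    using inner_weights_Ints \<alpha>_weight weight_lattice_iff by (metis inner_commute)
  then show ?thesis using iff by simp
qed

lemma regular_weight_count_eq:
  fixes m' p i :: nat
  assumes "prime p" "m' > 0" "\<not> p dvd m'"
  shows "regular_weight_count \<Phi> \<Delta> (p ^ i * m') p =
    card {b. (\<forall>i\<in>{1..8}. simple_root_pairing b i \<in> \<int>) \<and>
             (\<forall>i\<in>{1..8}. simple_root_pairing b i > 0) \<and> b $ 1 + b $ 2 < real (p ^ i)}"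
    (is "_ = card ?B")
proof -
  \<comment> \<open>The point with standard coordinates \<open>b\<close>, stretched by
    \<open>m'\<close>; it is the bijection from coordinate vectors to the weights counted.\<close>
  define G where "G b = real m' *\<^sub>R (\<Sum>i=1..8. simple_root_pairing b i *\<^sub>R \<omega> i)" for b
  have G: "G b \<bullet> \<alpha> i = real m' * simple_root_pairing b i" if "i \<in> {1..8}" for b i
    unfolding G_def inner_scaleR_left inner_sum_\<omega>[OF that] by simp
  have G8: "\<omega> 8 \<bullet> G b = real m' * (b $ 1 + b $ 2)" for b
  proof -
    let ?P = "simple_root_pairing b"
    have "\<omega> 8 \<bullet> G b = real m' * (2 * ?P 1 + 3 * ?P 2 + 4 * ?P 3 + 6 * ?P 4 + 5 * ?P 5 + 4 * ?P 6 + 3 * ?P 7 + 2 * ?P 8)"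
      unfolding inner_commute[of "\<omega> 8"] inner_\<omega>_8 sum_1_8
      by (simp add: G E8_inverse_cartan_def algebra_simps)
    \<comment> \<open>In coordinates the highest root is the sum of the first two unit
      vectors.\<close>
    also have "2 * ?P 1 + 3 * ?P 2 + 4 * ?P 3 + 6 * ?P 4 + 5 * ?P 5 + 4 * ?P 6 + 3 * ?P 7 + 2 * ?P 8 = b $ 1 + b $ 2"
      unfolding simple_root_pairing_simps by (simp add: field_simps)
    finally show ?thesis .
  qed
  define A where "A = {a \<in> regular_weights \<Phi> \<Delta> (p ^ i * m').
    \<forall>w\<in>weight_lattice \<Phi>. \<exists>q k. (w \<bullet> a) / real (p ^ i * m') = of_rat q \<and> snd (quotient_of q) = int p ^ k}"
  have A_iff: "a \<in> A \<longleftrightarrow> (1 / real m') *\<^sub>R a \<in> weight_lattice \<Phi> \<and> (\<forall>i\<in>{1..8}. 0 < \<alpha> i \<bullet> a) \<and> \<omega> 8 \<bullet> a < real (p ^ i * m')"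
    for a
  proof -
    have "a \<in> weight_lattice \<Phi>" if "(1 / real m') *\<^sub>R a \<in> weight_lattice \<Phi>"
      unfolding weight_lattice_iff
    proof
      fix i :: nat assume "i \<in> {1..8}"
      then have "(1 / real m') *\<^sub>R a \<bullet> \<alpha> i \<in> \<int>" using that weight_lattice_iff by blast
      then have "real m' * ((1 / real m') *\<^sub>R a \<bullet> \<alpha> i) \<in> \<int>" by (intro Ints_mult Ints_of_nat)
      then show "a \<bullet> \<alpha> i \<in> \<int>" using assms(2) by simp
    qed
    moreover have "a \<in> A \<longleftrightarrow> a \<in> weight_lattice \<Phi> \<and> (\<forall>i\<in>{1..8}. 0 < \<alpha> i \<bullet> a) \<and> \<omega> 8 \<bullet> a < real (p ^ i * m') \<and>
        (1 / real m') *\<^sub>R a \<in> weight_lattice \<Phi>"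
      unfolding A_def regular_weights_def interior_alcove
      \<comment> \<open>\<open>conj_cong\<close> supplies the premise that \<open>a\<close> is a
        weight.\<close>
      by (simp only: prime_power_denominators_iff[OF assms] mem_Collect_eq Int_iff conj_assoc cong: conj_cong)
    ultimately show ?thesis by blast
  qed
  have G_in_A: "G b \<in> A \<longleftrightarrow> b \<in> ?B" for b
  proof -
    have "(1 / real m') *\<^sub>R G b \<in> weight_lattice \<Phi> \<longleftrightarrow> (\<forall>i\<in>{1..8}. simple_root_pairing b i \<in> \<int>)"
      unfolding weight_lattice_iff using G assms(2) by (intro ball_cong) auto
    moreover have "(\<forall>i\<in>{1..8}. 0 < \<alpha> i \<bullet> G b) \<longleftrightarrow> (\<forall>i\<in>{1..8}. simple_root_pairing b i > 0)"
      unfolding inner_commute[of _ "G b"]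
      using G assms(2) by (intro ball_cong) (auto simp: zero_less_mult_iff)
    moreover have "\<omega> 8 \<bullet> G b < real (p ^ i * m') \<longleftrightarrow> b $ 1 + b $ 2 < real (p ^ i)"
      unfolding G8 using assms(2) by (simp add: mult.commute)
    ultimately show ?thesis unfolding A_iff by blast
  qed
  have "inj G"
  proof (rule injI)
    fix b b' assume "G b = G b'"
    have "simple_root_pairing b i = simple_root_pairing b' i" if "i \<in> {1..8}" for i
      using G[OF that, of b] G[OF that, of b'] assms(2) unfolding \<open>G b = G b'\<close> by simp
    then show "b = b'" by (intro simple_root_pairing_inject ballI)
  qed
  moreover have "G ` ?B = A"
  proof (intro equalityI subsetI)
    fix a assume "a \<in> A"
    obtain b where b: "\<forall>i\<in>{1..8}. simple_root_pairing b i = (a \<bullet> \<alpha> i) / real m'"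
      using simple_root_pairing_surj .
    \<comment> \<open>The vector \<open>b\<close> was chosen so that both points have equal inner
      products with all simple roots.\<close>
    have "G b - a = 0"
      by (rule eq_zeroI) (use b G assms(2) in \<open>simp add: inner_diff_left\<close>)
    then have "G b = a" by simp
    then show "a \<in> G ` ?B" using \<open>a \<in> A\<close> G_in_A by blast
  qed (use G_in_A in blast)
  ultimately have "card A = card ?B"
    using card_image[OF inj_on_subset[OF _ subset_UNIV], of G ?B] by simp
  then show ?thesis unfolding regular_weight_count_def A_def .
qed

end

theorem mainTheorem8:
  fixes \<Phi> \<Delta> :: "'a::euclidean_space set" and m m' p i :: nat
  assumes "root_system \<Phi>" and "root_base \<Phi> \<Delta>" and "type_E8 \<Delta>" and "normalized \<Phi>"
    and "m > 0" and "prime p"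
    and "m = p ^ i * m'" and "\<not> p dvd m'"
  shows "regular_weight_count \<Phi> \<Delta> m p =
    card {b :: real ^ 8.
      ((\<forall>j. b $ j \<in> \<int>) \<or> (\<forall>j. b $ j - 1 / 2 \<in> \<int>)) \<and>
      b $ 2 > b $ 3 \<and> b $ 3 > b $ 4 \<and> b $ 4 > b $ 5 \<and> b $ 5 > b $ 6 \<and> b $ 6 > b $ 7 \<and>
      b $ 7 > \<bar>b $ 8\<bar> \<and>
      b $ 1 > b $ 2 + b $ 3 + b $ 4 + b $ 5 + b $ 6 + b $ 7 - b $ 8 \<and>
      real (p ^ i) > b $ 1 + b $ 2 \<and>
      (\<exists>k::int. (\<Sum>j\<in>UNIV. b $ j) = 2 * of_int k)}"
proof -
  obtain \<alpha> :: "nat \<Rightarrow> 'a" where "bij_betw \<alpha> {1..8} \<Delta>"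
    "\<forall>i\<in>{1..8}. \<forall>j\<in>{1..8}. cartan_number (\<alpha> i) (\<alpha> j) = E8_cartan_matrix i j"
    using assms(3) unfolding type_E8_def by blast
  then interpret E8_roots \<Phi> \<Delta> \<alpha>
    using assms(1,2,4) by unfold_locales blast+
  have "m' > 0" using assms(5,7) by simp
  have Ints: "(\<forall>i\<in>{1..8}. simple_root_pairing b i \<in> \<int>) \<longleftrightarrow>
      ((\<forall>j. b $ j \<in> \<int>) \<or> (\<forall>j. b $ j - 1 / 2 \<in> \<int>)) \<and> (\<exists>k::int. (\<Sum>j\<in>UNIV. b $ j) = 2 * of_int k)" for b
    using simple_root_pairing_Ints_imp simple_root_pairing_Ints_if by blast
  \<comment> \<open>Pairings 2 and 3 combine into the condition on the absolute value of
    \<open>b $ 8\<close>.\<close>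
  have pos: "(\<forall>i\<in>{1..8}. simple_root_pairing b i > 0) \<longleftrightarrow>
      b $ 2 > b $ 3 \<and> b $ 3 > b $ 4 \<and> b $ 4 > b $ 5 \<and> b $ 5 > b $ 6 \<and> b $ 6 > b $ 7 \<and>
      b $ 7 > \<bar>b $ 8\<bar> \<and> b $ 1 > b $ 2 + b $ 3 + b $ 4 + b $ 5 + b $ 6 + b $ 7 - b $ 8" for b
    unfolding ball_1_8 simple_root_pairing_simps by auto
  show ?thesis
    unfolding assms(7) regular_weight_count_eq[OF assms(6) \<open>m' > 0\<close> assms(8)] Ints pos
    by (rule arg_cong[where f = card]) blast
qed

end
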